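(* Let $\mathcal{A}$ be a unital $C^*$-algebra, let $\phi:\mathcal{A}\to\mathbb{C}$ be a state, and let $x_1,\dots,x_n$ be self-adjoint elements of $\mathcal{A}$ with $\phi(x_j)=0$ for all $1\le j\le n$. Let $\sigma(x_j)=\sqrt{\phi(x_j^2)}$ be the standard deviation of $x_j$. Let $\left(\phi([x_i,x_j])\right)$ denote the $n\times n$ matrix with $(i,j)$ entry $\phi([x_i,x_j])$, and let $e_1,\dots,e_n$ be the standard basis of $\mathbb{C}^n$. Then $$\frac14\prod_{k=1}^n\left\langle \left|\left(\phi([x_i,x_j])\right)\right|e_k,e_k\right\rangle^{2/n}\le\left[\frac{\sum_{k=1}^n\sigma^2(x_k)}{n}\right]\left[\prod_{k=1}^n\sigma^2(x_k)\right]^{1/n}.$$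
   Context: A state is a positive linear functional $\phi$ with $\phi(1)=1$. The commutator is $[x,y]=xy-yx$. For a matrix $X$, $|X|=(X^*X)^{1/2}$ denotes its matrix absolute value. $\sigma^2(x)$ means $\sigma(x)^2$. *)

theory Defs
  imports Complex_Main "Jordan_Normal_Form.Schur_Decomposition"
begin

text \<open>
  Unital complex \<open>C\<^sup>*\<close>-algebras. The superclass \<open>real_normed_algebra_1\<close> includes
  \<open>norm 1 = 1\<close>, which follows from the \<open>C\<^sup>*\<close>-identity in every nonzero algebra; the zero
  algebra is thereby excluded, but it carries no state.
\<close>

class unital_cstar_algebra = real_normed_algebra_1 + banach +
  fixes scaleC :: "complex \<Rightarrow> 'a \<Rightarrow> 'a"  (infixr "*\<^sub>C" 75)
    and star :: "'a \<Rightarrow> 'a"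
  assumes scaleC_add_right: "c *\<^sub>C (x + y) = c *\<^sub>C x + c *\<^sub>C y"
    and scaleC_add_left: "(c + d) *\<^sub>C x = c *\<^sub>C x + d *\<^sub>C x"
    and scaleC_scaleC: "c *\<^sub>C d *\<^sub>C x = (c * d) *\<^sub>C x"
    and scaleC_complex_of_real: "complex_of_real r *\<^sub>C x = r *\<^sub>R x"
    and mult_scaleC_left: "(c *\<^sub>C x) * y = c *\<^sub>C (x * y)"
    and mult_scaleC_right: "x * (c *\<^sub>C y) = c *\<^sub>C (x * y)"
    and norm_scaleC: "norm (c *\<^sub>C x) = cmod c * norm x"
    and star_star: "star (star x) = x"
    and star_add: "star (x + y) = star x + star y"
    and star_scaleC: "star (c *\<^sub>C x) = cnj c *\<^sub>C star x"
    and star_mult: "star (x * y) = star y * star x"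
    and cstar_identity: "norm (star x * x) = (norm x)\<^sup>2"

definition self_adjoint :: "'a::unital_cstar_algebra \<Rightarrow> bool" where
  "self_adjoint x \<longleftrightarrow> star x = x"

definition commutator :: "'a::ring \<Rightarrow> 'a \<Rightarrow> 'a" where
  "commutator x y = x * y - y * x"

text \<open>
  The order on \<^typ>\<open>complex\<close> is the one for which \<open>0 \<le> z\<close> means that \<open>z\<close> is real and nonnegative.
\<close>

definition state :: "('a::unital_cstar_algebra \<Rightarrow> complex) \<Rightarrow> bool" where
  "state \<phi> \<longleftrightarrow> Vector_Spaces.linear (*\<^sub>C) (*) \<phi> \<and> (\<forall>a. 0 \<le> \<phi> (star a * a)) \<and> \<phi> 1 = 1"

text \<open>
  Standard deviation of a self-adjoint \<open>x\<close> with \<open>\<phi> x = 0\<close>. For a state \<open>\<phi>\<close> and self-adjoint \<open>x\<close>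
  the number \<open>\<phi> (x * x)\<close> is real and nonnegative, so \<open>Re\<close> is only a coercion.
\<close>

definition std_dev :: "('a::unital_cstar_algebra \<Rightarrow> complex) \<Rightarrow> 'a \<Rightarrow> real" where
  "std_dev \<phi> x = sqrt (Re (\<phi> (x\<^sup>2)))"

definition pos_semidef :: "complex mat \<Rightarrow> bool" where
  "pos_semidef A \<longleftrightarrow> square_mat A \<and> (\<forall>v \<in> carrier_vec (dim_row A). 0 \<le> (A *\<^sub>v v) \<bullet>c v)"

text \<open>The unique positive semidefinite square root; meaningful for positive semidefinite \<open>A\<close>.\<close>

definition mat_sqrt :: "complex mat \<Rightarrow> complex mat" where
  "mat_sqrt A = (THE B. pos_semidef B \<and> B * B = A)"

definition mat_abs :: "complex mat \<Rightarrow> complex mat" where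
  "mat_abs X = mat_sqrt (mat_adjoint X * X)"

end

theory Submission
  imports Defs "HOL-Analysis.Convex"
begin

text \<open>
  Let \<open>C\<close> be the matrix of the numbers \<open>\<phi> [x\<^sub>i, x\<^sub>j]\<close>. It is Hermitian, because the commutator of two
  self-adjoint elements is skew-adjoint and changes sign when the two are exchanged. By the spectral
  theorem \<open>\<bar>C\<bar> = U C\<close> for a Hermitian unitary \<open>U\<close> (\<open>hermitian_polar_decomposition\<close>). Hence the diagonal
  entry \<open>d\<^sub>k\<close> of \<open>\<bar>C\<bar>\<close> is again the value of \<open>\<phi>\<close> at a commutator, namely \<open>d\<^sub>k = \<phi> [y\<^sub>k, x\<^sub>k]\<close> with
  \<open>y\<^sub>k = \<Sum>\<^sub>j U\<^sub>k\<^sub>j x\<^sub>j\<close> (\<open>mixed_commutator\<close>).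

  The Cauchy--Schwarz inequality for \<open>\<phi>\<close> yields \<open>d\<^sub>k\<^sup>2 / 4 \<le> \<sigma>\<^sup>2(x\<^sub>k) r\<^sub>k\<close>, where
  \<open>r\<^sub>k = (\<phi> (y\<^sub>k y\<^sub>k\<^sup>*) + \<phi> (y\<^sub>k\<^sup>* y\<^sub>k)) / 2\<close> (\<open>state_commutator_bound\<close>). A single \<open>r\<^sub>k\<close> has no bound by
  \<open>\<sigma>\<^sup>2(x\<^sub>k)\<close>, but since \<open>U\<close> is unitary the sum of all \<open>r\<^sub>k\<close> equals the sum of all \<open>\<sigma>\<^sup>2(x\<^sub>k)\<close>
  (\<open>unitary_mixing_trace\<close>). Multiplying the inequalities over \<open>k\<close>, taking \<open>n\<close>-th roots and bounding the
  geometric mean of the \<open>r\<^sub>k\<close> by their arithmetic mean gives the claim. This last step is why an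
  arithmetic and a geometric mean of the variances stand side by side on the right.

  The absolute value is defined through \<^emph>\<open>the\<close> positive semidefinite square root, so the argument also
  needs its existence and uniqueness. Both rest on the fact that a nonzero Hermitian matrix has a nonzero
  eigenvalue (\<open>hermitian_nonzero_eigenvector\<close>).
\<close>

section \<open>Nonnegative sesquilinear expressions\<close>

text \<open>The expression in \<open>t\<close> is what a positive sesquilinear form gives on \<open>b + t a\<close>. Its reality forces the
  Hermitian symmetry of the form, and minimising it over \<open>t\<close> gives the Cauchy--Schwarz inequality.
  Isolating the two conclusions as facts about numbers lets them serve both positive semidefinite
  matrices and states.\<close>

lemma nonneg_quadratic_coefficients:
  fixes p q r s :: complex
  assumes nonneg: "\<And>t. 0 \<le> p + t * q + cnj t * r + t * cnj t * s" and s: "0 \<le> s"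
  shows "r = cnj q" and "(cmod q)\<^sup>2 \<le> Re p * Re s"
proof -
  have p: "0 \<le> Re p" "Im p = 0" and Ims: "Im s = 0" "0 \<le> Re s"
    using nonneg[of 0] s by (auto simp: less_eq_complex_def)
  have "Im q + Im r = 0" "Re q = Re r"
    \<comment> \<open>\<open>t = 1\<close> and \<open>t = \<i>\<close> compare the imaginary and the real parts.\<close>
    using nonneg[of 1] nonneg[of \<i>] p Ims by (auto simp: less_eq_complex_def)
  then show r: "r = cnj q" by (auto simp: complex_eq_iff)
  \<comment> \<open>For \<open>t\<close> antiparallel to \<open>cnj q\<close> both mixed terms are as negative as possible.\<close>
  have real_form: "0 \<le> Re p - 2 * T * (cmod q)\<^sup>2 + T\<^sup>2 * (cmod q)\<^sup>2 * Re s" for T :: real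
  proof -
    have e: "p + (- of_real T * cnj q) * q + cnj (- of_real T * cnj q) * r
        + (- of_real T * cnj q) * cnj (- of_real T * cnj q) * s
       = p - 2 * of_real T * (q * cnj q) + (of_real T)\<^sup>2 * (q * cnj q) * s"
      by (simp add: r power2_eq_square algebra_simps)
    have "Re (p - 2 * of_real T * (q * cnj q) + (of_real T)\<^sup>2 * (q * cnj q) * s)
       = Re p - 2 * T * (cmod q)\<^sup>2 + T\<^sup>2 * (cmod q)\<^sup>2 * Re s"
      unfolding complex_norm_square[symmetric]
      by (simp flip: of_real_power of_real_mult)
    with nonneg[of "- of_real T * cnj q"] show ?thesis
      unfolding e by (simp add: less_eq_complex_def)
  qed
  show "(cmod q)\<^sup>2 \<le> Re p * Re s"
  proof (cases "Re s = 0")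
    case True
    have "cmod q = 0"
    proof (rule ccontr)
      assume "cmod q \<noteq> 0"
      \<comment> \<open>The expression is now affine in \<open>T\<close>; at this \<open>T\<close> it is negative.\<close>
      then have "0 \<le> Re p - 2 * ((Re p + 1) / (cmod q)\<^sup>2) * (cmod q)\<^sup>2"
        using real_form[of "(Re p + 1) / (cmod q)\<^sup>2"] True by simp
      with \<open>cmod q \<noteq> 0\<close> p show False by simp
    qed
    with True show ?thesis by simp
  next
    case False
    then have "Re s > 0" using Ims by simp
    \<comment> \<open>\<open>T = 1 / Re s\<close> is the minimum of the real quadratic.\<close>
    moreover have "0 \<le> Re p - (cmod q)\<^sup>2 / Re s"
      using real_form[of "1 / Re s"] False by (simp add: power2_eq_square)
    ultimately show ?thesis by (simp add: field_simps)
  qed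
qed

section \<open>Hermitian matrices\<close>

lemma mat_adjoint_dim [simp]: "dim_row (mat_adjoint A) = dim_col A" "dim_col (mat_adjoint A) = dim_row A"
  by (simp_all add: mat_adjoint_def)

lemma mat_adjoint_index:
  fixes A :: "complex mat"
  assumes "i < dim_col A" "j < dim_row A"
  shows "mat_adjoint A $$ (i, j) = cnj (A $$ (j, i))"
  using assms by (simp add: mat_adjoint_def mat_of_rows_def)

definition hermitian :: "complex mat \<Rightarrow> bool" where
  "hermitian A \<longleftrightarrow> mat_adjoint A = A"

lemma hermitian_iff:
  assumes "A \<in> carrier_mat n n"
  shows "hermitian A \<longleftrightarrow> (\<forall>i<n. \<forall>j<n. cnj (A $$ (i, j)) = A $$ (j, i))"
proof
  assume "hermitian A"
  then show "\<forall>i<n. \<forall>j<n. cnj (A $$ (i, j)) = A $$ (j, i)"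
    using assms mat_adjoint_index[of _ A] unfolding hermitian_def by (metis carrier_matD)
next
  assume h: "\<forall>i<n. \<forall>j<n. cnj (A $$ (i, j)) = A $$ (j, i)"
  show "hermitian A" unfolding hermitian_def
    by (rule eq_matI) (use assms h in \<open>auto simp: mat_adjoint_index\<close>)
qed

lemma hermitian_index:
  "A \<in> carrier_mat n n \<Longrightarrow> hermitian A \<Longrightarrow> i < n \<Longrightarrow> j < n \<Longrightarrow> cnj (A $$ (i, j)) = A $$ (j, i)"
  by (simp add: hermitian_iff)

lemma cscalar_prod_sum:
  fixes v w :: "complex vec"
  assumes "v \<in> carrier_vec n" "w \<in> carrier_vec n"
  shows "v \<bullet>c w = (\<Sum>i<n. v $ i * cnj (w $ i))"
  using assms by (auto simp: scalar_prod_def lessThan_atLeast0)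

lemma mult_mat_vec_sum:
  assumes "A \<in> carrier_mat n n" "v \<in> carrier_vec n" "i < n"
  shows "(A *\<^sub>v v) $ i = (\<Sum>j<n. A $$ (i, j) * v $ j)"
  using assms by (auto simp: scalar_prod_def lessThan_atLeast0)

lemma mult_mat_sum:
  assumes "A \<in> carrier_mat n n" "B \<in> carrier_mat n n" "i < n" "j < n"
  shows "(A * B) $$ (i, j) = (\<Sum>k<n. A $$ (i, k) * B $$ (k, j))"
  using assms by (auto simp: scalar_prod_def lessThan_atLeast0)

lemma hermitian_cscalar_prod:
  assumes A: "A \<in> carrier_mat n n" "hermitian A" and v: "v \<in> carrier_vec n" and w: "w \<in> carrier_vec n"
  shows "(A *\<^sub>v v) \<bullet>c w = v \<bullet>c (A *\<^sub>v w)"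
proof -
  have h: "cnj (A $$ (i, j)) = A $$ (j, i)" if "i < n" "j < n" for i j
    using A that by (rule hermitian_index)
  have "(A *\<^sub>v v) \<bullet>c w = (\<Sum>i<n. (\<Sum>j<n. A $$ (i, j) * v $ j) * cnj (w $ i))"
    using A v w by (subst cscalar_prod_sum[of _ n]) (auto simp: mult_mat_vec_sum[of _ n] simp del: index_mult_mat_vec)
  also have "\<dots> = (\<Sum>j<n. \<Sum>i<n. A $$ (i, j) * v $ j * cnj (w $ i))"
    unfolding sum_distrib_right by (rule sum.swap)
  also have "\<dots> = (\<Sum>j<n. v $ j * cnj (\<Sum>i<n. A $$ (j, i) * w $ i))"
    by (simp add: sum_distrib_left h mult_ac)
  also have "\<dots> = v \<bullet>c (A *\<^sub>v w)"
    using A v w by (subst cscalar_prod_sum[of _ n]) (auto simp: mult_mat_vec_sum[of _ n] simp del: index_mult_mat_vec)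
  finally show ?thesis .
qed

lemma cscalar_prod_cnj:
  fixes v w :: "complex vec"
  assumes "v \<in> carrier_vec n" "w \<in> carrier_vec n"
  shows "cnj (v \<bullet>c w) = w \<bullet>c v"
  using assms by (simp add: cscalar_prod_sum[of _ n] mult.commute)

lemma trace_mult_commute:
  fixes A B :: "complex mat"
  assumes "A \<in> carrier_mat n n" "B \<in> carrier_mat n n"
  shows "(\<Sum>i<n. (A * B) $$ (i, i)) = (\<Sum>i<n. (B * A) $$ (i, i))"
proof -
  have "(\<Sum>i<n. (A * B) $$ (i, i)) = (\<Sum>i<n. \<Sum>k<n. A $$ (i, k) * B $$ (k, i))"
    using assms by (simp add: mult_mat_sum[of _ n] del: index_mult_mat)
  also have "\<dots> = (\<Sum>k<n. \<Sum>i<n. A $$ (i, k) * B $$ (k, i))" by (rule sum.swap)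
  also have "\<dots> = (\<Sum>i<n. (B * A) $$ (i, i))"
    using assms by (simp add: mult_mat_sum[of _ n] mult.commute del: index_mult_mat)
  finally show ?thesis .
qed

text \<open>Over the complex numbers \<open>A\<close> is similar to an upper triangular matrix \<open>B\<close>. If all eigenvalues were
  zero then \<open>B\<close> would be strictly upper triangular and \<open>B\<^sup>2\<close> would have zero diagonal. But the trace of
  \<open>B\<^sup>2\<close> is that of \<open>A\<^sup>2\<close>, which for Hermitian \<open>A\<close> is the sum of all \<open>\<bar>A\<^sub>i\<^sub>k\<bar>\<^sup>2\<close>.\<close>

lemma hermitian_nonzero_eigenvector:
  assumes A: "A \<in> carrier_mat n n" "hermitian A" and nz: "A \<noteq> 0\<^sub>m n n"
  obtains l w where "l \<noteq> (0::real)" "w \<in> carrier_vec n" "w \<bullet>c w = 1" "A *\<^sub>v w = of_real l \<cdot>\<^sub>v w"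
proof -
  obtain as where cp: "char_poly A = (\<Prod>a\<leftarrow>as. [:- a, 1:])" using char_poly_factorized[OF A(1)] by auto
  obtain B P Q where sd: "schur_decomposition A as = (B, P, Q)" by (metis prod_cases3)
  from schur_decomposition[OF A(1) cp sd]
  have sim: "similar_mat_wit A B P Q" and ut: "upper_triangular B" and dg: "diag_mat B = as" by auto
  note simD = similar_mat_witD2[OF A(1) sim]
  have B: "B \<in> carrier_mat n n" and P: "P \<in> carrier_mat n n" and Q: "Q \<in> carrier_mat n n"
    and QP: "Q * P = 1\<^sub>m n" and AB: "A = P * B * Q" using simD by auto
  have "\<exists>i<n. B $$ (i, i) \<noteq> 0"
  proof (rule ccontr)
    assume "\<not> ?thesis"
    then have z: "B $$ (i, j) = 0" if "j \<le> i" "i < n" for i j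
      using ut B that by (cases "i = j") (auto simp: upper_triangular_def)
    have "A * A = P * (B * (Q * P) * B * Q)" unfolding AB using B P Q by (simp add: assoc_mult_mat[of _ n n _ n _ n])
    then have AA: "A * A = P * (B * B * Q)" using QP B by simp
    have "(\<Sum>i<n. (A * A) $$ (i, i)) = (\<Sum>i<n. ((B * B * Q) * P) $$ (i, i))"
      unfolding AA using B P Q by (intro trace_mult_commute) auto
    also have "(B * B * Q) * P = B * B" using B P Q QP by (simp add: assoc_mult_mat[of _ n n _ n _ n])
    also have "(\<Sum>i<n. (B * B) $$ (i, i)) = 0"
    proof (intro sum.neutral ballI)
      fix i assume "i \<in> {..<n}"
      then have "B $$ (i, k) * B $$ (k, i) = 0" if "k < n" for k
        using z[of k i] z[of i k] that by (cases "k \<le> i") auto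
      with \<open>i \<in> {..<n}\<close> show "(B * B) $$ (i, i) = 0"
        using B by (simp add: mult_mat_sum[of _ n] sum.neutral del: index_mult_mat mult_eq_0_iff)
    qed
    finally have "(\<Sum>i<n. \<Sum>k<n. A $$ (i, k) * A $$ (k, i)) = 0"
      using A(1) by (simp add: mult_mat_sum[of _ n] del: index_mult_mat)
    moreover have "A $$ (i, k) * A $$ (k, i) = of_real ((cmod (A $$ (i, k)))\<^sup>2)" if "i < n" "k < n" for i k
      unfolding complex_norm_square hermitian_index[OF A that] ..
    ultimately have "of_real (\<Sum>i<n. \<Sum>k<n. (cmod (A $$ (i, k)))\<^sup>2) = (0::complex)"
      by (simp del: of_real_power)
    then have "(\<Sum>i<n. \<Sum>k<n. (cmod (A $$ (i, k)))\<^sup>2) = 0" by (simp only: of_real_eq_0_iff)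
    then have "\<forall>i<n. \<forall>k<n. A $$ (i, k) = 0"
      by (simp add: sum_nonneg_eq_0_iff sum_nonneg)
    then have "A = 0\<^sub>m n n" using A(1) by (intro eq_matI) auto
    with nz show False by simp
  qed
  then obtain i where i: "i < n" "B $$ (i, i) \<noteq> 0" by auto
  define c where "c = B $$ (i, i)"
  have "c \<in> set as" using i B unfolding dg[symmetric] c_def diag_mat_def by auto
  then have "poly (char_poly A) c = 0" unfolding cp poly_prod_list by (auto simp: prod_list_zero_iff)
  then obtain v where v: "v \<in> carrier_vec n" "v \<noteq> 0\<^sub>v n" and ev: "A *\<^sub>v v = c \<cdot>\<^sub>v v"
    using eigenvalue_root_char_poly[OF A(1)] A(1) unfolding eigenvalue_def eigenvector_def by auto
  have pos: "v \<bullet>c v > 0" using v by simp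
  define N where "N = Re (v \<bullet>c v)"
  have N: "N > 0" "v \<bullet>c v = of_real N" using pos unfolding N_def
    by (auto simp: less_complex_def complex_eq_iff)
  \<comment> \<open>Moving \<open>A\<close> across \<open>v \<bullet>c v\<close> shows that the eigenvalue is real.\<close>
  have "c * (v \<bullet>c v) = cnj c * (v \<bullet>c v)"
    using hermitian_cscalar_prod[OF A v(1) v(1)] v(1) unfolding ev by (simp add: conjugate_smult_vec)
  then have "cnj c = c" using pos by auto
  then obtain l where l: "c = of_real l" by (metis Reals_cnj_iff Reals_cases)
  show ?thesis
  proof
    show "l \<noteq> 0" using i l c_def by auto
    let ?w = "of_real (1 / sqrt N) \<cdot>\<^sub>v v"
    show "?w \<in> carrier_vec n" using v by simp
    have "?w \<bullet>c ?w = of_real (1 / sqrt N) * of_real (1 / sqrt N) * of_real N"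
      using v N by (simp add: conjugate_smult_vec)
    also have "\<dots> = of_real ((1 / sqrt N) * (1 / sqrt N) * N)" by (simp only: of_real_mult)
    also have "\<dots> = 1" using N by simp
    finally show "?w \<bullet>c ?w = 1" .
    show "A *\<^sub>v ?w = of_real l \<cdot>\<^sub>v ?w"
      using A v ev l by (simp add: mult_mat_vec[of _ n n] smult_smult_assoc mult.commute)
  qed
qed

section \<open>Positive semidefinite matrices and their square roots\<close>

lemma cscalar_prod_unit_vec:
  fixes v :: "complex vec"
  assumes "v \<in> carrier_vec n" "i < n"
  shows "v \<bullet>c unit_vec n i = v $ i"
proof -
  have "v \<bullet>c unit_vec n i = (\<Sum>j<n. if j = i then v $ j else 0)"
    unfolding cscalar_prod_sum[OF assms(1) unit_vec_carrier] using assms by (intro sum.cong) auto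
  with assms show ?thesis by simp
qed

lemma mat_index_eq_cscalar_prod:
  fixes B :: "complex mat"
  assumes "B \<in> carrier_mat n n" "i < n" "j < n"
  shows "(B *\<^sub>v unit_vec n j) \<bullet>c unit_vec n i = B $$ (i, j)"
  using assms by (subst cscalar_prod_unit_vec) auto

lemma pos_semidef_form:
  assumes B: "B \<in> carrier_mat n n" "pos_semidef B" and v: "v \<in> carrier_vec n" and w: "w \<in> carrier_vec n"
  shows "(B *\<^sub>v v) \<bullet>c w = v \<bullet>c (B *\<^sub>v w)"
    and "(cmod ((B *\<^sub>v v) \<bullet>c w))\<^sup>2 \<le> Re ((B *\<^sub>v w) \<bullet>c w) * Re ((B *\<^sub>v v) \<bullet>c v)"
proof -
  have nonneg: "0 \<le> (B *\<^sub>v x) \<bullet>c x" if "x \<in> carrier_vec n" for x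
    using B that unfolding pos_semidef_def by auto
  have "0 \<le> (B *\<^sub>v w) \<bullet>c w + t * ((B *\<^sub>v v) \<bullet>c w) + cnj t * ((B *\<^sub>v w) \<bullet>c v)
      + t * cnj t * ((B *\<^sub>v v) \<bullet>c v)" for t
  proof -
    have "(B *\<^sub>v (w + t \<cdot>\<^sub>v v)) \<bullet>c (w + t \<cdot>\<^sub>v v) = (B *\<^sub>v w) \<bullet>c w + t * ((B *\<^sub>v v) \<bullet>c w)
        + cnj t * ((B *\<^sub>v w) \<bullet>c v) + t * cnj t * ((B *\<^sub>v v) \<bullet>c v)"
      using B v w
      by (simp add: mult_add_distrib_mat_vec[of _ n n] mult_mat_vec[of _ n n] conjugate_add_vec[of _ n]
          conjugate_smult_vec add_scalar_prod_distrib[of _ n] scalar_prod_add_distrib[of _ n] algebra_simps)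
    with nonneg[of "w + t \<cdot>\<^sub>v v"] v w show ?thesis by simp
  qed
  note * = nonneg_quadratic_coefficients[OF this nonneg[OF v]]
  show "(cmod ((B *\<^sub>v v) \<bullet>c w))\<^sup>2 \<le> Re ((B *\<^sub>v w) \<bullet>c w) * Re ((B *\<^sub>v v) \<bullet>c v)" by (rule *(2))
  have "v \<bullet>c (B *\<^sub>v w) = cnj ((B *\<^sub>v w) \<bullet>c v)"
    using B v w by (subst cscalar_prod_cnj[of _ n]) auto
  with *(1) show "(B *\<^sub>v v) \<bullet>c w = v \<bullet>c (B *\<^sub>v w)" by simp
qed

lemma pos_semidef_hermitian:
  assumes B: "B \<in> carrier_mat n n" "pos_semidef B"
  shows "hermitian B"
  unfolding hermitian_iff[OF B(1)]
proof (intro allI impI)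
  fix i j assume ij: "i < n" "j < n"
  then have "cnj (B $$ (i, j)) = cnj (unit_vec n j \<bullet>c (B *\<^sub>v unit_vec n i))"
    using pos_semidef_form(1)[OF B, of "unit_vec n j" "unit_vec n i"] B(1)
    by (simp flip: mat_index_eq_cscalar_prod)
  also have "\<dots> = B $$ (j, i)"
    using ij B(1) by (subst cscalar_prod_cnj[of _ n]) (auto simp flip: mat_index_eq_cscalar_prod)
  finally show "cnj (B $$ (i, j)) = B $$ (j, i)" .
qed

lemma pos_semidef_kernel:
  assumes B: "B \<in> carrier_mat n n" "pos_semidef B" and v: "v \<in> carrier_vec n" and z: "(B *\<^sub>v v) \<bullet>c v = 0"
  shows "B *\<^sub>v v = 0\<^sub>v n"
proof -
  have Bv: "B *\<^sub>v v \<in> carrier_vec n" using B v by auto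
  have "(B *\<^sub>v v) \<bullet>c (B *\<^sub>v v) = 0"
    using pos_semidef_form(2)[OF B v Bv] z by simp
  with Bv show ?thesis by (simp only: conjugate_square_eq_0_vec)
qed

text \<open>For \<open>D = B - C\<close> the equation \<open>B\<^sup>2 = C\<^sup>2\<close> gives \<open>B D + D C = 0\<close>. Evaluated at an eigenvector \<open>w\<close> of
  \<open>D\<close> with nonzero eigenvalue, this says that the nonnegative numbers \<open>\<langle>B w, w\<rangle>\<close> and \<open>\<langle>C w, w\<rangle>\<close> add up
  to zero, so \<open>w\<close> is in the kernel of \<open>B\<close>, of \<open>C\<close>, and thus of \<open>D\<close>, a contradiction. So \<open>D\<close> has no
  nonzero eigenvalue.\<close>

lemma pos_semidef_sqrt_unique:
  assumes B: "B \<in> carrier_mat n n" "pos_semidef B" and C: "C \<in> carrier_mat n n" "pos_semidef C"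
    and eq: "B * B = C * C"
  shows "B = C"
proof (rule ccontr)
  assume "B \<noteq> C"
  define D where "D = B - C"
  have D: "D \<in> carrier_mat n n" unfolding D_def using B C by auto
  have "hermitian D"
    using hermitian_index[OF B(1) pos_semidef_hermitian[OF B]]
      hermitian_index[OF C(1) pos_semidef_hermitian[OF C]] B C
    unfolding hermitian_iff[OF D] by (simp add: D_def)
  moreover have "D \<noteq> 0\<^sub>m n n"
  proof
    assume "D = 0\<^sub>m n n"
    then have "B $$ (i, j) - C $$ (i, j) = 0" if "i < n" "j < n" for i j
      using that B C index_minus_mat(1)[of i C j B] by (simp add: D_def)
    then have "B = C" using B C by (intro eq_matI) auto
    with \<open>B \<noteq> C\<close> show False ..
  qed
  ultimately obtain l w where l: "l \<noteq> (0::real)" and w: "w \<in> carrier_vec n" "w \<bullet>c w = 1"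
    and ev: "D *\<^sub>v w = of_real l \<cdot>\<^sub>v w"
    using hermitian_nonzero_eigenvector[OF D] by metis
  have Bw: "B *\<^sub>v w \<in> carrier_vec n" and Cw: "C *\<^sub>v w \<in> carrier_vec n" using B C w by auto
  have "B * D + D * C = 0\<^sub>m n n"
    using B C eq unfolding D_def
    by (simp add: mult_minus_distrib_mat[of _ n n] minus_mult_distrib_mat[of _ n n]) (rule eq_matI, auto)
  moreover have "0\<^sub>m n n *\<^sub>v w = 0\<^sub>v n" using w by (intro eq_vecI) auto
  ultimately have "((B * D + D * C) *\<^sub>v w) \<bullet>c w = 0" using w by simp
  also have "((B * D + D * C) *\<^sub>v w) = B *\<^sub>v (D *\<^sub>v w) + D *\<^sub>v (C *\<^sub>v w)"
    using B C D w by (simp add: add_mult_distrib_mat_vec[of _ n n] assoc_mult_mat_vec[of _ n n _ n])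
  also have "(B *\<^sub>v (D *\<^sub>v w) + D *\<^sub>v (C *\<^sub>v w)) \<bullet>c w
     = (B *\<^sub>v (D *\<^sub>v w)) \<bullet>c w + (D *\<^sub>v (C *\<^sub>v w)) \<bullet>c w"
    using B C D w by (intro add_scalar_prod_distrib[of _ n]) auto
  also have "(D *\<^sub>v (C *\<^sub>v w)) \<bullet>c w = (C *\<^sub>v w) \<bullet>c (D *\<^sub>v w)"
    by (rule hermitian_cscalar_prod[OF D \<open>hermitian D\<close> Cw w(1)])
  also have "(B *\<^sub>v (D *\<^sub>v w)) \<bullet>c w + (C *\<^sub>v w) \<bullet>c (D *\<^sub>v w)
     = of_real l * ((B *\<^sub>v w) \<bullet>c w + (C *\<^sub>v w) \<bullet>c w)"
    using B C w Bw Cw unfolding ev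
    by (simp add: mult_mat_vec[of _ n n] conjugate_smult_vec algebra_simps)
  finally have "(B *\<^sub>v w) \<bullet>c w + (C *\<^sub>v w) \<bullet>c w = 0" using l by simp
  moreover have "0 \<le> (B *\<^sub>v w) \<bullet>c w" "0 \<le> (C *\<^sub>v w) \<bullet>c w"
    using B C w unfolding pos_semidef_def by auto
  ultimately have "(B *\<^sub>v w) \<bullet>c w = 0" "(C *\<^sub>v w) \<bullet>c w = 0"
    by (simp_all add: add_nonneg_eq_0_iff)
  then have "B *\<^sub>v w = 0\<^sub>v n" "C *\<^sub>v w = 0\<^sub>v n"
    using pos_semidef_kernel[OF B w(1)] pos_semidef_kernel[OF C w(1)] by simp_all
  then have "D *\<^sub>v w = 0\<^sub>v n"
    using B C w unfolding D_def by (simp add: minus_mult_distrib_mat_vec[of _ n n])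
  with ev have "of_real l \<cdot>\<^sub>v w = 0\<^sub>v n" by simp
  then have "(of_real l \<cdot>\<^sub>v w) \<bullet>c w = 0" using w by simp
  with w l show False by simp
qed

section \<open>Spectral decomposition and polar decomposition\<close>

definition orthonormal :: "nat \<Rightarrow> nat \<Rightarrow> (nat \<Rightarrow> complex vec) \<Rightarrow> bool" where
  "orthonormal n m v \<longleftrightarrow> (\<forall>p<m. v p \<in> carrier_vec n) \<and> (\<forall>p<m. \<forall>q<m. v p \<bullet>c v q = of_bool (p = q))"

text \<open>The matrix \<open>\<Sum>\<^sub>p g\<^sub>p v\<^sub>p v\<^sub>p\<^sup>*\<close>. For an orthonormal family \<open>v\<close> that need not span the space it acts on
  \<open>v\<^sub>p\<close> as \<open>g\<^sub>p\<close> and as zero on the orthogonal complement, so that \<open>g \<mapsto> spectral_mat n m v g\<close> is a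
  functional calculus.\<close>

definition spectral_mat :: "nat \<Rightarrow> nat \<Rightarrow> (nat \<Rightarrow> complex vec) \<Rightarrow> (nat \<Rightarrow> complex) \<Rightarrow> complex mat" where
  "spectral_mat n m v g = mat n n (\<lambda>(i, j). \<Sum>p<m. g p * v p $ i * cnj (v p $ j))"

lemma spectral_mat_carrier [simp]: "spectral_mat n m v g \<in> carrier_mat n n"
  "dim_row (spectral_mat n m v g) = n" "dim_col (spectral_mat n m v g) = n"
  by (simp_all add: spectral_mat_def)

lemma spectral_mat_index:
  "i < n \<Longrightarrow> j < n \<Longrightarrow> spectral_mat n m v g $$ (i, j) = (\<Sum>p<m. g p * v p $ i * cnj (v p $ j))"
  by (simp add: spectral_mat_def)

lemma spectral_mat_mult_vec:
  assumes v: "orthonormal n m v" and w: "w \<in> carrier_vec n" and i: "i < n"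
  shows "(spectral_mat n m v g *\<^sub>v w) $ i = (\<Sum>p<m. g p * (w \<bullet>c v p) * v p $ i)"
proof -
  have "(spectral_mat n m v g *\<^sub>v w) $ i = (\<Sum>j<n. \<Sum>p<m. g p * v p $ i * cnj (v p $ j) * w $ j)"
    using w i by (subst mult_mat_vec_sum[of _ n]) (auto simp: spectral_mat_index sum_distrib_right)
  also have "\<dots> = (\<Sum>p<m. \<Sum>j<n. g p * v p $ i * cnj (v p $ j) * w $ j)" by (rule sum.swap)
  also have "\<dots> = (\<Sum>p<m. g p * (w \<bullet>c v p) * v p $ i)"
    using v w by (intro sum.cong) (auto simp: orthonormal_def cscalar_prod_sum[of _ n] sum_distrib_left
        sum_distrib_right mult_ac)
  finally show ?thesis .
qed

lemma spectral_mat_eigenvector: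
  assumes v: "orthonormal n m v" and q: "q < m"
  shows "spectral_mat n m v g *\<^sub>v v q = g q \<cdot>\<^sub>v v q"
proof (rule eq_vecI)
  have vq: "v q \<in> carrier_vec n" using v q by (simp add: orthonormal_def)
  then show "dim_vec (spectral_mat n m v g *\<^sub>v v q) = dim_vec (g q \<cdot>\<^sub>v v q)" by simp
  fix i assume "i < dim_vec (g q \<cdot>\<^sub>v v q)"
  then have i: "i < n" using vq by simp
  have "(spectral_mat n m v g *\<^sub>v v q) $ i = (\<Sum>p<m. if q = p then g p * v p $ i else 0)"
    unfolding spectral_mat_mult_vec[OF v vq i]
    using v q by (intro sum.cong) (auto simp: orthonormal_def)
  with q i vq show "(spectral_mat n m v g *\<^sub>v v q) $ i = (g q \<cdot>\<^sub>v v q) $ i" by simp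
qed

lemma spectral_mat_mult:
  assumes v: "orthonormal n m v"
  shows "spectral_mat n m v g * spectral_mat n m v h = spectral_mat n m v (\<lambda>p. g p * h p)"
proof (rule eq_matI)
  fix i j assume "i < dim_row (spectral_mat n m v (\<lambda>p. g p * h p))" "j < dim_col (spectral_mat n m v (\<lambda>p. g p * h p))"
  then have ij: "i < n" "j < n" by auto
  have "(spectral_mat n m v g * spectral_mat n m v h) $$ (i, j)
      = (\<Sum>k<n. \<Sum>q<m. spectral_mat n m v g $$ (i, k) * v q $ k * h q * cnj (v q $ j))"
    using ij by (subst mult_mat_sum[of _ n]) (auto simp: spectral_mat_index[of _ n _ _ _ h] sum_distrib_left mult_ac)
  also have "\<dots> = (\<Sum>q<m. \<Sum>k<n. spectral_mat n m v g $$ (i, k) * v q $ k * h q * cnj (v q $ j))"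
    by (rule sum.swap)
  also have "\<dots> = (\<Sum>q<m. (spectral_mat n m v g *\<^sub>v v q) $ i * h q * cnj (v q $ j))"
    using v ij by (intro sum.cong refl, subst mult_mat_vec_sum[of _ n])
      (auto simp: orthonormal_def sum_distrib_right)
  also have "\<dots> = (\<Sum>q<m. g q * h q * v q $ i * cnj (v q $ j))"
    using v ij by (intro sum.cong refl) (auto simp: spectral_mat_eigenvector orthonormal_def carrier_vecD mult_ac)
  finally show "(spectral_mat n m v g * spectral_mat n m v h) $$ (i, j) = spectral_mat n m v (\<lambda>p. g p * h p) $$ (i, j)"
    using ij by (simp add: spectral_mat_index)
qed auto

lemma spectral_mat_hermitian:
  assumes "\<And>p. p < m \<Longrightarrow> cnj (g p) = g p"
  shows "hermitian (spectral_mat n m v g)"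
  unfolding hermitian_iff[OF spectral_mat_carrier(1)]
  using assms by (auto simp: spectral_mat_index intro!: sum.cong)

lemma spectral_mat_pos_semidef:
  assumes v: "orthonormal n m v" and g: "\<And>p. p < m \<Longrightarrow> 0 \<le> g p"
  shows "pos_semidef (spectral_mat n m v g)"
  unfolding pos_semidef_def
proof (intro conjI ballI)
  fix w :: "complex vec" assume "w \<in> carrier_vec (dim_row (spectral_mat n m v g))"
  then have w: "w \<in> carrier_vec n" by simp
  have "(spectral_mat n m v g *\<^sub>v w) \<bullet>c w = (\<Sum>i<n. \<Sum>p<m. g p * (w \<bullet>c v p) * v p $ i * cnj (w $ i))"
    using w v by (subst cscalar_prod_sum[OF mult_mat_vec_carrier[OF spectral_mat_carrier(1)]])
      (auto simp: spectral_mat_mult_vec sum_distrib_right simp del: index_mult_mat_vec)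
  also have "\<dots> = (\<Sum>p<m. \<Sum>i<n. g p * (w \<bullet>c v p) * v p $ i * cnj (w $ i))" by (rule sum.swap)
  also have "\<dots> = (\<Sum>p<m. g p * ((w \<bullet>c v p) * cnj (w \<bullet>c v p)))"
  proof (intro sum.cong refl)
    fix p assume "p \<in> {..<m}"
    then have vp: "v p \<in> carrier_vec n" using v by (simp add: orthonormal_def)
    show "(\<Sum>i<n. g p * (w \<bullet>c v p) * v p $ i * cnj (w $ i)) = g p * ((w \<bullet>c v p) * cnj (w \<bullet>c v p))"
      unfolding cscalar_prod_cnj[OF w vp] cscalar_prod_sum[OF vp w] by (simp add: sum_distrib_left mult_ac)
  qed
  also have "0 \<le> \<dots>"
    by (rule sum_nonneg, rule mult_nonneg_nonneg) (use g in \<open>auto simp: less_eq_complex_def\<close>)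
  finally show "0 \<le> (spectral_mat n m v g *\<^sub>v w) \<bullet>c w" .
qed simp

text \<open>The projection \<open>E = \<Sum>\<^sub>p v\<^sub>p v\<^sub>p\<^sup>*\<close> has trace \<open>m\<close>. Since \<open>E = E E\<^sup>*\<close>, each diagonal entry
  dominates its own square and is at most \<open>1\<close>, so the trace is at most \<open>n\<close>.\<close>

lemma orthonormal_card_le:
  assumes v: "orthonormal n m v"
  shows "m \<le> n"
proof -
  define E where "E = spectral_mat n m v (\<lambda>_. 1)"
  have E: "E \<in> carrier_mat n n" "hermitian E" unfolding E_def by (auto intro: spectral_mat_hermitian)
  have EE: "E * E = E" unfolding E_def spectral_mat_mult[OF v] by simp
  have diag: "Re (E $$ (i, i)) \<le> 1" if i: "i < n" for i
  proof -
    have "E $$ (i, i) = (\<Sum>k<n. E $$ (i, k) * E $$ (k, i))"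
      using mult_mat_sum[OF E(1) E(1) i i] EE by simp
    also have "\<dots> = (\<Sum>k<n. of_real ((cmod (E $$ (i, k)))\<^sup>2))"
      by (intro sum.cong refl, unfold complex_norm_square) (use i hermitian_index[OF E] in auto)
    finally have "Re (E $$ (i, i)) = (\<Sum>k<n. (cmod (E $$ (i, k)))\<^sup>2)" by simp
    also have "\<dots> \<ge> (cmod (E $$ (i, i)))\<^sup>2"
      using i member_le_sum[of i "{..<n}" "\<lambda>k. (cmod (E $$ (i, k)))\<^sup>2"] by auto
    finally have "(Re (E $$ (i, i)))\<^sup>2 \<le> Re (E $$ (i, i))"
      using cmod_power2[of "E $$ (i, i)"] by (smt (verit) zero_le_power2)
    then have "0 \<le> Re (E $$ (i, i)) * (1 - Re (E $$ (i, i)))" by (simp add: power2_eq_square algebra_simps)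
    then show ?thesis by (smt (verit) mult_pos_neg mult_nonneg_nonneg zero_le_mult_iff)
  qed
  have "(\<Sum>i<n. E $$ (i, i)) = (\<Sum>p<m. \<Sum>i<n. v p $ i * cnj (v p $ i))"
    unfolding E_def by (subst sum.swap) (simp add: spectral_mat_index)
  also have "\<dots> = (\<Sum>p<m. 1)"
    using v by (intro sum.cong refl, subst cscalar_prod_sum[of _ n, symmetric]) (auto simp: orthonormal_def)
  finally have "real m = Re (\<Sum>i<n. E $$ (i, i))" by simp
  also have "\<dots> \<le> (\<Sum>i<n. 1)" unfolding Re_sum by (intro sum_mono diag) simp
  finally show ?thesis by simp
qed

text \<open>Deflation. For an orthonormal family of eigenvectors of maximal size, subtract from \<open>A\<close> the part that
  the family explains. The remainder \<open>M\<close> is Hermitian and kills the family, so an eigenvector of \<open>M\<close>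
  with nonzero eigenvalue is orthogonal to the family; it is then also an eigenvector of \<open>A\<close>, which
  would extend the family. So \<open>M\<close> has no nonzero eigenvalue and vanishes.\<close>

lemma hermitian_spectral_decomposition:
  assumes A: "A \<in> carrier_mat n n" "hermitian A"
  obtains m v and l :: "nat \<Rightarrow> real"
  where "orthonormal n m v" "A = spectral_mat n m v (\<lambda>p. of_real (l p))"
proof -
  define eig where "eig m v l \<longleftrightarrow> orthonormal n m v \<and> (\<forall>p<m. A *\<^sub>v v p = of_real (l p) \<cdot>\<^sub>v v p)"
    for m v and l :: "nat \<Rightarrow> real"
  define P where "P m \<longleftrightarrow> (\<exists>v l. eig m v l)" for m
  have "P 0" by (auto simp: P_def eig_def orthonormal_def)
  moreover have bound: "\<forall>m. P m \<longrightarrow> m \<le> n" using orthonormal_card_le by (auto simp: P_def eig_def)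
  ultimately have "P (Greatest P)" by (metis GreatestI_nat)
  define m where "m = Greatest P"
  obtain v l where vl: "eig m v l" using \<open>P (Greatest P)\<close> unfolding m_def P_def by blast
  have v: "orthonormal n m v" and ev: "\<And>p. p < m \<Longrightarrow> A *\<^sub>v v p = of_real (l p) \<cdot>\<^sub>v v p"
    using vl by (auto simp: eig_def)
  have vc: "v p \<in> carrier_vec n" if "p < m" for p using v that by (simp add: orthonormal_def)
  define S where "S = spectral_mat n m v (\<lambda>p. of_real (l p))"
  have S: "S \<in> carrier_mat n n" "hermitian S" by (auto simp: S_def intro: spectral_mat_hermitian)
  define M where "M = A - S"
  have M: "M \<in> carrier_mat n n" unfolding M_def using A S by auto
  have hM: "hermitian M"
    using hermitian_index[OF A] hermitian_index[OF S] A(1) S(1)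
    unfolding hermitian_iff[OF M] by (simp add: M_def)
  have Mv: "M *\<^sub>v v p = 0\<^sub>v n" if "p < m" for p
    using A S vc[OF that] ev[OF that] unfolding M_def S_def
    by (simp add: minus_mult_distrib_mat_vec[of _ n n] spectral_mat_eigenvector[OF v that])
  have "M = 0\<^sub>m n n"
  proof (rule ccontr)
    assume "M \<noteq> 0\<^sub>m n n"
    then obtain c w where c: "c \<noteq> (0::real)" and w: "w \<in> carrier_vec n" "w \<bullet>c w = 1"
      and Mw: "M *\<^sub>v w = of_real c \<cdot>\<^sub>v w"
      using hermitian_nonzero_eigenvector[OF M hM] by metis
    have orth: "w \<bullet>c v p = 0" if p: "p < m" for p
    proof -
      have "of_real c * (w \<bullet>c v p) = (M *\<^sub>v w) \<bullet>c v p" unfolding Mw using w vc[OF p] by simp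
      also have "\<dots> = w \<bullet>c (M *\<^sub>v v p)" by (rule hermitian_cscalar_prod[OF M hM w(1) vc[OF p]])
      also have "\<dots> = 0" unfolding Mv[OF p] using w by simp
      finally show ?thesis using c by simp
    qed
    have orth': "v p \<bullet>c w = 0" if p: "p < m" for p
      using cscalar_prod_cnj[OF w(1) vc[OF p]] orth[OF p] by simp
    have Sw: "S *\<^sub>v w = 0\<^sub>v n"
      by (rule eq_vecI) (use S w orth in \<open>auto simp: S_def spectral_mat_mult_vec[OF v] simp del: index_mult_mat_vec\<close>)
    have "M *\<^sub>v w = A *\<^sub>v w" unfolding M_def using A S w Sw
      by (simp add: minus_mult_distrib_mat_vec[of _ n n])
    then have "eig (Suc m) (v(m := w)) (l(m := c))"
      using v w orth orth' ev Mw unfolding eig_def orthonormal_def by (auto simp: less_Suc_eq)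
    then have "P (Suc m)" unfolding P_def by blast
    then have "Suc m \<le> m" unfolding m_def using bound by (intro Greatest_le_nat) auto
    then show False by simp
  qed
  have "A = S"
  proof (rule eq_matI)
    fix i j assume "i < dim_row S" "j < dim_col S"
    then show "A $$ (i, j) = S $$ (i, j)"
      using \<open>M = 0\<^sub>m n n\<close> S index_minus_mat(1)[of i S j A] by (simp add: M_def)
  qed (use A S in auto)
  with v show ?thesis unfolding S_def by (rule that)
qed

text \<open>With \<open>A = \<Sum>\<^sub>p l\<^sub>p v\<^sub>p v\<^sub>p\<^sup>*\<close> the absolute value is \<open>\<Sum>\<^sub>p \<bar>l\<^sub>p\<bar> v\<^sub>p v\<^sub>p\<^sup>*\<close>, and \<open>U\<close> is the reflection that
  changes the sign on the eigenvectors with negative eigenvalue. Letting \<open>U\<close> be the identity elsewhere,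
  also on the kernel of \<open>A\<close>, makes it unitary and not merely a partial isometry.\<close>

lemma hermitian_polar_decomposition:
  assumes A: "A \<in> carrier_mat n n" "hermitian A"
  obtains U where "U \<in> carrier_mat n n" "hermitian U" "U * U = 1\<^sub>m n"
    "mat_abs A = U * A" "pos_semidef (mat_abs A)"
proof -
  obtain m v and l :: "nat \<Rightarrow> real" where v: "orthonormal n m v" and Al: "A = spectral_mat n m v (\<lambda>p. of_real (l p))"
    using hermitian_spectral_decomposition[OF A] .
  let ?S = "spectral_mat n m v"
  define k where "k p = (if l p < 0 then 2 else 0 :: complex)" for p
  define U where "U = 1\<^sub>m n - ?S k"
  define B where "B = ?S (\<lambda>p. of_real \<bar>l p\<bar>)"
  have diff: "?S g - ?S h = ?S (\<lambda>p. g p - h p)" for g h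
    by (rule eq_matI) (auto simp: spectral_mat_index left_diff_distrib sum_subtractf)
  have U: "U \<in> carrier_mat n n" unfolding U_def by auto
  have "hermitian (?S k)" by (rule spectral_mat_hermitian) (simp add: k_def)
  then have hU: "hermitian U"
    unfolding hermitian_iff[OF U] using hermitian_index[OF spectral_mat_carrier(1)] by (auto simp: U_def)
  have UB: "U * A = B"
  proof -
    have "U * A = ?S (\<lambda>p. of_real (l p)) - ?S k * ?S (\<lambda>p. of_real (l p))"
      unfolding U_def Al by (subst minus_mult_distrib_mat[of _ n n]) auto
    also have "\<dots> = B" unfolding B_def spectral_mat_mult[OF v] diff
      by (rule arg_cong[of _ _ ?S]) (auto simp: k_def)
    finally show ?thesis .
  qed
  have UU: "U * U = 1\<^sub>m n"
  proof -
    have "U * U = 1\<^sub>m n * U - ?S k * U"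
      unfolding minus_mult_distrib_mat[OF one_carrier_mat spectral_mat_carrier(1) U, symmetric]
      by (simp flip: U_def)
    also have "\<dots> = U - (?S k - ?S k * ?S k)"
      unfolding left_mult_one_mat[OF U] by (subst (2) U_def, subst mult_minus_distrib_mat[of _ n n]) auto
    also have "?S k - ?S k * ?S k = ?S (\<lambda>p. - k p)" unfolding spectral_mat_mult[OF v] diff
      by (rule arg_cong[of _ _ ?S]) (auto simp: k_def)
    also have "U - ?S (\<lambda>p. - k p) = 1\<^sub>m n"
      unfolding U_def by (rule eq_matI) (auto simp: spectral_mat_index sum_negf)
    finally show ?thesis .
  qed
  have B: "B \<in> carrier_mat n n" "pos_semidef B" unfolding B_def
    by (auto intro!: spectral_mat_pos_semidef[OF v] simp: less_eq_complex_def)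
  have AA: "mat_adjoint A * A = B * B"
    using A(2) unfolding hermitian_def
    by (simp add: Al B_def spectral_mat_mult[OF v] flip: of_real_mult)
  have "mat_abs A = B" unfolding mat_abs_def mat_sqrt_def AA
  proof (rule the_equality)
    fix B' assume h: "pos_semidef B' \<and> B' * B' = B * B"
    then have "dim_row B' = n" using B(1) by (metis carrier_matD(1) index_mult_mat(2))
    then have "B' \<in> carrier_mat n n" using h by (auto simp: pos_semidef_def)
    then show "B' = B" using pos_semidef_sqrt_unique[OF _ _ B] h by blast
  qed (use B in simp)
  with U hU UU UB B show ?thesis by (intro that[of U]) simp_all
qed

section \<open>States on unital C*-algebras\<close>

lemma star_diff: "star (x - y) = star x - star (y::'a::unital_cstar_algebra)"
  using star_add[of "x - y" y] by (simp add: algebra_simps)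

lemma star_zero [simp]: "star (0::'a::unital_cstar_algebra) = 0"
  using star_diff[of "0::'a" 0] by simp

lemma star_one: "star (1::'a::unital_cstar_algebra) = 1"
  using star_mult[of "star 1" "1::'a"] by (simp add: star_star)

lemma star_sum: "star (\<Sum>i\<in>I. f i) = (\<Sum>i\<in>I. star (f i :: 'a::unital_cstar_algebra))"
  by (induction I rule: infinite_finite_induct) (simp_all add: star_add)

context
  fixes \<phi> :: "'a::unital_cstar_algebra \<Rightarrow> complex"
  assumes state: "state \<phi>"
begin

lemma state_add: "\<phi> (a + b) = \<phi> a + \<phi> b"
  and state_scale: "\<phi> (c *\<^sub>C a) = c * \<phi> a"
  using state by (auto simp: state_def Vector_Spaces.linear_def module_hom_def module_hom_axioms_def)

lemma state_diff: "\<phi> (a - b) = \<phi> a - \<phi> b"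
  using state_add[of "a - b" b] by simp

lemma state_sum: "\<phi> (\<Sum>i\<in>I. f i) = (\<Sum>i\<in>I. \<phi> (f i))"
  using state_diff[of 0 0] by (induction I rule: infinite_finite_induct) (simp_all add: state_add)

lemma state_nonneg: "0 \<le> \<phi> (star a * a)"
  using state by (simp add: state_def)

lemma
  shows state_Cauchy_Schwarz: "(cmod (\<phi> (star b * a)))\<^sup>2 \<le> Re (\<phi> (star a * a)) * Re (\<phi> (star b * b))"
    and state_star: "\<phi> (star a) = cnj (\<phi> a)"
proof -
  have "0 \<le> \<phi> (star b * b) + t * \<phi> (star b * a) + cnj t * \<phi> (star a * b) + t * cnj t * \<phi> (star a * a)" for t b
  proof -
    have "star (b + t *\<^sub>C a) * (b + t *\<^sub>C a) = star b * b + t *\<^sub>C (star b * a) + cnj t *\<^sub>C (star a * b)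
       + (t * cnj t) *\<^sub>C (star a * a)"
      by (simp add: star_add star_scaleC distrib_left distrib_right mult_scaleC_left mult_scaleC_right
          scaleC_scaleC mult.commute[of t] add_ac scaleC_add_right)
    with state_nonneg[of "b + t *\<^sub>C a"] show ?thesis by (simp add: state_add state_scale)
  qed
  note coeffs = nonneg_quadratic_coefficients[OF this state_nonneg]
  show "(cmod (\<phi> (star b * a)))\<^sup>2 \<le> Re (\<phi> (star a * a)) * Re (\<phi> (star b * b))"
    using coeffs(2)[of b] by (simp add: mult.commute)
  show "\<phi> (star a) = cnj (\<phi> a)" using coeffs(1)[of 1] by (simp add: star_one)
qed

text \<open>The two products in the commutator are bounded by Cauchy--Schwarz separately. As \<open>y\<close> need not be
  self-adjoint, they give the two different second moments \<open>\<phi> (y y\<^sup>*)\<close> and \<open>\<phi> (y\<^sup>* y)\<close>.\<close>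

lemma state_commutator_bound:
  assumes x: "self_adjoint x"
  shows "(cmod (\<phi> (commutator y x)))\<^sup>2
    \<le> 2 * (std_dev \<phi> x)\<^sup>2 * (Re (\<phi> (y * star y)) + Re (\<phi> (star y * y)))"
proof -
  let ?s = "Re (\<phi> (x * x))" and ?a = "Re (\<phi> (y * star y))" and ?b = "Re (\<phi> (star y * y))"
  have x': "star x = x" using x by (simp add: self_adjoint_def)
  have s: "?s \<ge> 0" using state_nonneg[of x] x' by (simp add: less_eq_complex_def)
  have yx: "(cmod (\<phi> (y * x)))\<^sup>2 \<le> ?s * ?a"
    using state_Cauchy_Schwarz[of "star y" x] by (simp add: star_star x')
  have xy: "(cmod (\<phi> (x * y)))\<^sup>2 \<le> ?b * ?s"
    using state_Cauchy_Schwarz[of x y] by (simp add: x')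
  have "cmod (\<phi> (commutator y x)) \<le> cmod (\<phi> (y * x)) + cmod (\<phi> (x * y))"
    unfolding commutator_def state_diff by (rule norm_triangle_ineq4)
  then have "(cmod (\<phi> (commutator y x)))\<^sup>2 \<le> (cmod (\<phi> (y * x)) + cmod (\<phi> (x * y)))\<^sup>2"
    by (intro power_mono) auto
  also have "\<dots> \<le> 2 * (cmod (\<phi> (y * x)))\<^sup>2 + 2 * (cmod (\<phi> (x * y)))\<^sup>2"
    using zero_le_power2[of "cmod (\<phi> (y * x)) - cmod (\<phi> (x * y))"]
    by (simp add: power2_sum power2_diff)
  also have "\<dots> \<le> 2 * (?s * ?a) + 2 * (?b * ?s)" using yx xy by simp
  also have "\<dots> = 2 * (std_dev \<phi> x)\<^sup>2 * (?a + ?b)"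
    using s by (simp add: std_dev_def power2_eq_square algebra_simps)
  finally show ?thesis .
qed

lemma state_sum_mult_sum:
  "\<phi> ((\<Sum>i\<in>I. c i *\<^sub>C x i) * (\<Sum>j\<in>J. d j *\<^sub>C z j)) = (\<Sum>i\<in>I. \<Sum>j\<in>J. c i * d j * \<phi> (x i * z j))"
  by (simp add: sum_product state_sum mult_scaleC_left mult_scaleC_right state_scale mult_ac)

text \<open>A unitary change of the family \<open>x\<close> leaves the trace of its matrix of second moments unchanged. For
  products in either order the coefficients combine to the entries of \<open>U U\<close>, because \<open>U\<close> is its own
  adjoint.\<close>

lemma unitary_mixing_trace:
  assumes U: "U \<in> carrier_mat n n" "hermitian U" "U * U = 1\<^sub>m n"
    and x: "\<And>j. j < n \<Longrightarrow> self_adjoint (x j)"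
    and y: "\<And>k. y k = (\<Sum>j<n. U $$ (k, j) *\<^sub>C x j)"
  shows "(\<Sum>k<n. \<phi> (y k * star (y k))) = (\<Sum>k<n. \<phi> (x k * x k))"
    and "(\<Sum>k<n. \<phi> (star (y k) * y k)) = (\<Sum>k<n. \<phi> (x k * x k))"
proof -
  have sy: "star (y k) = (\<Sum>j<n. U $$ (j, k) *\<^sub>C x j)" if "k < n" for k
    unfolding y star_sum star_scaleC using x that hermitian_index[OF U(1,2)]
    by (intro sum.cong) (auto simp: self_adjoint_def)
  have UU: "(\<Sum>k<n. U $$ (i, k) * U $$ (k, j)) = of_bool (i = j)" if "i < n" "j < n" for i j
    using mult_mat_sum[OF U(1) U(1) that] that unfolding U(3) by (auto simp: of_bool_def)
  have UU': "(\<Sum>k<n. U $$ (k, i) * U $$ (j, k)) = of_bool (i = j)" if "i < n" "j < n" for i j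
  proof -
    have "(\<Sum>k<n. U $$ (k, i) * U $$ (j, k)) = (\<Sum>k<n. U $$ (j, k) * U $$ (k, i))"
      by (rule sum.cong[OF refl mult.commute])
    also have "\<dots> = of_bool (i = j)" unfolding UU[OF that(2,1)] by auto
    finally show ?thesis .
  qed
  have rotate: "(\<Sum>k<n. \<Sum>i<n. \<Sum>j<n. f k i j) = (\<Sum>i<n. \<Sum>j<n. \<Sum>k<n. f k i j)"
    for f :: "nat \<Rightarrow> nat \<Rightarrow> nat \<Rightarrow> complex"
    by (rule trans[OF sum.swap], rule sum.cong[OF refl], rule sum.swap)
  have collapse: "(\<Sum>i<n. \<Sum>j<n. of_bool (i = j) * \<phi> (x i * x j)) = (\<Sum>k<n. \<phi> (x k * x k))"
  proof (rule sum.cong[OF refl])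
    fix i assume "i \<in> {..<n}"
    then have "(\<Sum>j<n. if i = j then \<phi> (x i * x j) else 0) = \<phi> (x i * x i)" by simp
    then show "(\<Sum>j<n. of_bool (i = j) * \<phi> (x i * x j)) = \<phi> (x i * x i)"
      by (simp add: of_bool_def if_distrib[of "\<lambda>b. b * _"] cong: if_cong)
  qed
  have "(\<Sum>k<n. \<phi> (y k * star (y k))) = (\<Sum>k<n. \<Sum>i<n. \<Sum>j<n. U $$ (k, i) * U $$ (j, k) * \<phi> (x i * x j))"
    using sy by (simp add: y state_sum_mult_sum)
  also have "\<dots> = (\<Sum>i<n. \<Sum>j<n. \<Sum>k<n. U $$ (k, i) * U $$ (j, k) * \<phi> (x i * x j))"
    by (rule rotate)
  also have "\<dots> = (\<Sum>i<n. \<Sum>j<n. of_bool (i = j) * \<phi> (x i * x j))"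
    by (intro sum.cong refl) (simp add: UU' flip: sum_distrib_right)
  finally show "(\<Sum>k<n. \<phi> (y k * star (y k))) = (\<Sum>k<n. \<phi> (x k * x k))" unfolding collapse .
  have "(\<Sum>k<n. \<phi> (star (y k) * y k)) = (\<Sum>k<n. \<Sum>i<n. \<Sum>j<n. U $$ (i, k) * U $$ (k, j) * \<phi> (x i * x j))"
    using sy by (simp add: y state_sum_mult_sum)
  also have "\<dots> = (\<Sum>i<n. \<Sum>j<n. \<Sum>k<n. U $$ (i, k) * U $$ (k, j) * \<phi> (x i * x j))"
    by (rule rotate)
  also have "\<dots> = (\<Sum>i<n. \<Sum>j<n. of_bool (i = j) * \<phi> (x i * x j))"
    by (intro sum.cong refl) (simp add: UU flip: sum_distrib_right)
  finally show "(\<Sum>k<n. \<phi> (star (y k) * y k)) = (\<Sum>k<n. \<phi> (x k * x k))" unfolding collapse .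
qed

lemma commutator_mat_hermitian:
  assumes x: "\<And>j. j < n \<Longrightarrow> self_adjoint (x j)"
  shows "hermitian (mat n n (\<lambda>(i, j). \<phi> (commutator (x i) (x j))))"
proof -
  have "cnj (\<phi> (commutator (x i) (x j))) = \<phi> (commutator (x j) (x i))" if "i < n" "j < n" for i j
    using x[OF that(1)] x[OF that(2)] unfolding state_star[symmetric]
    by (simp add: commutator_def star_diff star_mult self_adjoint_def)
  then show ?thesis by (subst hermitian_iff[of _ n]) auto
qed

text \<open>The commutator is linear in its left argument, so multiplying the commutator matrix by \<open>U\<close> from the
  left replaces the left entries \<open>x\<^sub>j\<close> by their mixtures with the rows of \<open>U\<close>.\<close>

lemma mixed_commutator:
  assumes U: "U \<in> carrier_mat n n" and k: "k < n"
  shows "(U * mat n n (\<lambda>(i, j). \<phi> (commutator (x i) (x j)))) $$ (k, k)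
    = \<phi> (commutator (\<Sum>j<n. U $$ (k, j) *\<^sub>C x j) (x k))"
  using assms
  by (subst mult_mat_sum[of _ n])
    (auto simp: commutator_def sum_distrib_left sum_distrib_right state_diff state_sum mult_scaleC_left
       mult_scaleC_right state_scale right_diff_distrib sum_subtractf)

end

section \<open>The uncertainty relation\<close>

theorem corollary2:
  fixes \<phi> :: "'a::unital_cstar_algebra \<Rightarrow> complex"
    and x :: "nat \<Rightarrow> 'a"
    and n :: nat
  assumes "n \<ge> 1"
    and "state \<phi>"
    and "\<And>j. j < n \<Longrightarrow> self_adjoint (x j)"
    and "\<And>j. j < n \<Longrightarrow> \<phi> (x j) = 0"
  shows "1 / 4 * (\<Prod>k<n. Re ((mat_abs (mat n n (\<lambda>(i, j). \<phi> (commutator (x i) (x j))))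
                              *\<^sub>v unit_vec n k) \<bullet>c unit_vec n k) powr (2 / real n))
         \<le> ((\<Sum>k<n. (std_dev \<phi> (x k))\<^sup>2) / real n)
            * (\<Prod>k<n. (std_dev \<phi> (x k))\<^sup>2) powr (1 / real n)"
proof -
  let ?C = "mat n n (\<lambda>(i, j). \<phi> (commutator (x i) (x j)))"
  have C: "?C \<in> carrier_mat n n" by simp
  obtain U where U: "U \<in> carrier_mat n n" "hermitian U" "U * U = 1\<^sub>m n"
    and abs: "mat_abs ?C = U * ?C" and psd: "pos_semidef (mat_abs ?C)"
    using hermitian_polar_decomposition[OF C commutator_mat_hermitian[OF assms(2,3)]] by metis
  have absC: "mat_abs ?C \<in> carrier_mat n n" unfolding abs using U by simp
  define d where "d k = Re ((mat_abs ?C *\<^sub>v unit_vec n k) \<bullet>c unit_vec n k)" for k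
  \<comment> \<open>\<open>r k\<close> is the symmetrised second moment of the mixture \<open>y k\<close>, which need not be self-adjoint.\<close>
  define y where "y k = (\<Sum>j<n. U $$ (k, j) *\<^sub>C x j)" for k
  define v where "v k = (std_dev \<phi> (x k))\<^sup>2" for k
  define r where "r k = (Re (\<phi> (y k * star (y k))) + Re (\<phi> (star (y k) * y k))) / 2" for k
  have d_nonneg: "0 \<le> d k" for k
    using psd absC unfolding d_def pos_semidef_def by (simp add: less_eq_complex_def)
  have v_nonneg: "0 \<le> v k" for k by (simp add: v_def)
  have r_nonneg: "0 \<le> r k" for k
    using state_nonneg[OF assms(2), of "y k"] state_nonneg[OF assms(2), of "star (y k)"]
    by (simp add: r_def star_star less_eq_complex_def)
  have v: "v k = Re (\<phi> (x k * x k))" if "k < n" for k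
    using state_nonneg[OF assms(2), of "x k"] assms(3)[OF that]
    by (simp add: v_def std_dev_def self_adjoint_def power2_eq_square less_eq_complex_def)
  have bound: "1 / 4 * (d k)\<^sup>2 \<le> v k * r k" if "k < n" for k
  proof -
    have "d k = Re (\<phi> (commutator (y k) (x k)))"
      unfolding d_def mat_index_eq_cscalar_prod[OF absC that that]
      unfolding abs y_def mixed_commutator[OF assms(2) U(1) that] ..
    then have "(d k)\<^sup>2 \<le> (cmod (\<phi> (commutator (y k) (x k))))\<^sup>2"
      using d_nonneg[of k] complex_Re_le_cmod by (simp add: power_mono)
    also have "\<dots> \<le> 4 * (v k * r k)"
      using state_commutator_bound[OF assms(2) assms(3)[OF that], of "y k"] by (simp add: v_def r_def)
    finally show ?thesis by simp
  qed
  have sum_r: "(\<Sum>k<n. r k) = (\<Sum>k<n. v k)"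
  proof -
    have trace: "(\<Sum>k<n. \<phi> (y k * star (y k))) = (\<Sum>k<n. \<phi> (x k * x k))"
      "(\<Sum>k<n. \<phi> (star (y k) * y k)) = (\<Sum>k<n. \<phi> (x k * x k))"
      using unitary_mixing_trace[OF assms(2) U _ y_def] assms(3) by blast+
    have "(\<Sum>k<n. r k) = (Re (\<Sum>k<n. \<phi> (y k * star (y k))) + Re (\<Sum>k<n. \<phi> (star (y k) * y k))) / 2"
      by (simp add: r_def sum.distrib flip: sum_divide_distrib)
    also have "\<dots> = (\<Sum>k<n. v k)"
      unfolding trace by (simp add: v)
    finally show ?thesis .
  qed
  have n: "real n > 0" using assms(1) by simp
  have "1 / 4 * (\<Prod>k<n. d k powr (2 / real n)) = (\<Prod>k<n. (1 / 4 * (d k)\<^sup>2) powr (1 / real n))"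
  proof -
    have "(1 / 4 * (d k)\<^sup>2) powr (1 / real n) = (1 / 4) powr (1 / real n) * d k powr (2 / real n)" for k
    proof -
      have "(d k)\<^sup>2 = d k powr 2" using d_nonneg[of k] by simp
      then show ?thesis unfolding powr_mult by (simp only: powr_powr) simp
    qed
    moreover have "(\<Prod>k<n. (1 / 4) powr (1 / real n)) = (1 / 4 :: real)"
      using n by (simp add: powr_powr flip: powr_realpow[of "(1 / 4) powr (1 / real n)"])
    ultimately show ?thesis by (simp only: prod.distrib)
  qed
  also have "\<dots> \<le> (\<Prod>k<n. (v k * r k) powr (1 / real n))"
    by (intro prod_mono conjI powr_mono2) (use bound in auto)
  also have "\<dots> = (\<Prod>k<n. v k) powr (1 / real n) * (\<Prod>k<n. r k) powr (1 / real n)"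
    using v_nonneg r_nonneg by (simp add: powr_mult prod.distrib prod_powr_distrib)
  also have "\<dots> \<le> (\<Prod>k<n. v k) powr (1 / real n) * ((\<Sum>k<n. v k) / real n)"
  proof (rule mult_left_mono)
    show "(\<Prod>k<n. r k) powr (1 / real n) \<le> (\<Sum>k<n. v k) / real n"
    proof -
      have "{..<n} \<noteq> {}" using assms(1) by (auto simp: lessThan_empty_iff)
      from arith_geom_mean[OF finite_lessThan this, of r] r_nonneg show ?thesis
        using sum_r by (simp flip: sum_divide_distrib)
    qed
  qed simp
  finally show ?thesis unfolding d_def v_def by (simp add: mult.commute)
qed

end
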